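(* Let $L>0$, let $f:\mathbb{R}^n\to\mathbb{R}$ be convex and $L$-smooth, let $g:\mathbb{R}^n\to(-\infty,+\infty]$ be proper, closed and convex, and let $\varphi=f+g$, assumed to attain its minimum value $\min\varphi$. Let $0<t\le\frac1L$ and assume that $\varphi$ satisfies the generalized Polyak-Łojasiewicz inequality for some $\eta>0$: $$\frac12\|\mathcal{G}_t(x)\|^2\ge \eta\,(\varphi(x)-\min\varphi)\qquad\text{for all }x\in\operatorname{dom}\varphi.$$ Let $x\in\operatorname{dom}\varphi$ and let $x^+=x-t\,\mathcal{G}_t(x)$. Then $$\varphi(x^+)-\min\varphi\le \frac{1-\eta t}{1+\eta t}\,(\varphi(x)-\min\varphi).$$
   Context: $\mathbb{R}^n$ is Euclidean space with induced norm $\|\cdot\|$. A differentiable function $f:\mathbb{R}^n\to\mathbb{R}$ is $L$-smooth if $\|\nabla f(x)-\nabla f(y)\|\le L\|x-y\|$ for all $x,y\in\mathbb{R}^n$. $\operatorname{dom}\varphi=\{x\in\mathbb{R}^n:\varphi(x)<+\infty\}$. For $t>0$ and $g$ proper closed convex, $\mathbf{prox}_{tg}(x):=\arg\min_{u\in\mathbb{R}^n}\{t g(u)+\frac12\|u-x\|^2\}$, and the proximal gradient is $\mathcal{G}_t(x):=t^{-1}\left(x-\mathbf{prox}_{tg}(x-t\nabla f(x))\right)$. *)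

theory Defs
  imports "HOL-Analysis.Analysis"
begin

definition gradient :: "('a::real_inner \<Rightarrow> real) \<Rightarrow> 'a \<Rightarrow> 'a" where
  "gradient f x = (THE D. GDERIV f x :> D)"

lemma gradient_eqI: "gradient f x = D" if "GDERIV f x :> D"
  unfolding gradient_def
proof (rule the_equality)
  fix E assume "GDERIV f x :> E"
  with that have "(\<lambda>h. inner h E) = (\<lambda>h. inner h D)"
    unfolding gderiv_def by (blast intro: has_derivative_unique)
  then show "E = D"
    by (metis inner_commute vector_eq_rdot)
qed (rule that)

definition L_smooth :: "real \<Rightarrow> ('a::real_inner \<Rightarrow> real) \<Rightarrow> bool" where
  "L_smooth L f \<longleftrightarrow> (\<forall>x. f differentiable (at x)) \<and>
     (\<forall>x y. norm (gradient f x - gradient f y) \<le> L * norm (x - y))"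

definition edom :: "('a \<Rightarrow> ereal) \<Rightarrow> 'a set" where
  "edom h = {x. h x < \<infinity>}"

(* The library's epigraph is restricted to real-valued functions. The height is real here too,
   so that the epigraph lives in the vector space 'a * real. *)
definition eepigraph :: "('a \<Rightarrow> ereal) \<Rightarrow> ('a \<times> real) set" where
  "eepigraph h = {(x, r). h x \<le> ereal r}"

definition proper_fun :: "('a \<Rightarrow> ereal) \<Rightarrow> bool" where
  "proper_fun h \<longleftrightarrow> (\<forall>x. h x \<noteq> -\<infinity>) \<and> edom h \<noteq> {}"

definition closed_fun :: "('a::topological_space \<Rightarrow> ereal) \<Rightarrow> bool" where
  "closed_fun h \<longleftrightarrow> closed (eepigraph h)"

definition convex_fun :: "('a::real_vector \<Rightarrow> ereal) \<Rightarrow> bool" where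
  "convex_fun h \<longleftrightarrow> convex (eepigraph h)"

definition attains_min :: "('a \<Rightarrow> ereal) \<Rightarrow> bool" where
  "attains_min h \<longleftrightarrow> (\<exists>x. \<forall>y. h x \<le> h y)"

(* Meaningful only if attains_min h holds. *)
definition min_value :: "('a \<Rightarrow> ereal) \<Rightarrow> ereal" where
  "min_value h = (LEAST m. m \<in> range h)"

(* For t > 0 and g proper, closed and convex on a Euclidean space the minimizer exists and is
   unique, so the choice made by ARG_MIN is immaterial. *)
definition prox :: "real \<Rightarrow> ('a::real_inner \<Rightarrow> ereal) \<Rightarrow> 'a \<Rightarrow> 'a" where
  "prox t g x = (ARG_MIN (\<lambda>u. ereal t * g u + ereal (1/2 * (norm (u - x))\<^sup>2)) u. True)"

definition prox_gradient ::
  "real \<Rightarrow> ('a::real_inner \<Rightarrow> real) \<Rightarrow> ('a \<Rightarrow> ereal) \<Rightarrow> 'a \<Rightarrow> 'a" where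
  "prox_gradient t f g x = (1 / t) *\<^sub>R (x - prox t g (x - t *\<^sub>R gradient f x))"

end

theory Submission
  imports Defs
begin

text \<open>
  Write \<open>G(x)\<close> for the proximal gradient at \<open>x\<close> and \<open>m\<close> for the minimum of
  \<open>\<phi> = f + g\<close>. The usual sufficient decrease estimate bounds \<open>\<phi>(x) - \<phi>(x\<^sup>+)\<close> from below by a
  multiple of \<open>\<parallel>G(x)\<parallel>\<^sup>2\<close> alone. The rate claimed here comes from the sharper, symmetric estimate
  \<open>\<phi>(x) - \<phi>(x\<^sup>+) \<ge> t/2 \<parallel>G(x)\<parallel>\<^sup>2 + t/2 \<parallel>G(x\<^sup>+)\<parallel>\<^sup>2\<close> (\<open>prox_gradient_step_decrease\<close>): the
  Polyak-Lojasiewicz inequality applied at both end points turns its right-hand side into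
  \<open>\<eta> t (\<phi>(x) - m) + \<eta> t (\<phi>(x\<^sup>+) - m)\<close>, and collecting terms gives
  \<open>(1 + \<eta> t) (\<phi>(x\<^sup>+) - m) \<le> (1 - \<eta> t) (\<phi>(x) - m)\<close>.

  For the symmetric estimate, put \<open>s = G(x) - \<nabla>f(x)\<close>. By the optimality condition of the proximal
  map (\<open>prox_is_subgradient\<close>), \<open>s\<close> is a subgradient of \<open>g\<close> at \<open>x\<^sup>+\<close>, so that
  \<open>H = \<nabla>f(x\<^sup>+) + s\<close> is a subgradient of \<open>\<phi>\<close> there. Add the subgradient inequality
  for \<open>g\<close> to the strengthened tangent inequality for convex smooth functions
  (\<open>convex_L_smooth_lower_bound\<close>), both taken at \<open>x\<^sup>+\<close>. Since \<open>x - x\<^sup>+ = t G(x)\<close> and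
  \<open>\<nabla>f(x) - \<nabla>f(x\<^sup>+) = G(x) - H\<close>, the result is
  \<open>\<phi>(x) - \<phi>(x\<^sup>+) \<ge> t \<langle>H, G(x)\<rangle> + t/2 \<parallel>G(x) - H\<parallel>\<^sup>2 = t/2 \<parallel>G(x)\<parallel>\<^sup>2 + t/2 \<parallel>H\<parallel>\<^sup>2\<close>.
  Finally \<open>\<parallel>G(x\<^sup>+)\<parallel> \<le> \<parallel>H\<parallel>\<close>, because the proximal gradient at a point is never longer than a
  subgradient of \<open>\<phi>\<close> at that point (\<open>norm_prox_gradient_le\<close>, from monotonicity of the
  subdifferential of \<open>g\<close>).

  All this presupposes that the proximal minimization problem has a solution
  (\<open>prox_minimizes\<close>). A closed proper convex function has an affine minorant, so
  adding the quadratic term makes the sublevel sets of the objective bounded, and compactness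
  applies.
\<close>

section \<open>Smooth convex functions\<close>

text \<open>The gradient represents the derivative: evaluate the adjoint of the derivative at 1.\<close>
lemma GDERIV_gradient:
  fixes f :: "'a::euclidean_space \<Rightarrow> real"
  assumes "f differentiable (at x)"
  shows "GDERIV f x :> gradient f x"
proof -
  obtain f' where f': "(f has_derivative f') (at x)"
    using assms by (auto simp: differentiable_def)
  then have "linear f'"
    by (rule has_derivative_linear)
  then have "f' h = inner h (adjoint f' 1)" for h
    using adjoint_works[of f' h 1] by simp
  then have "f' = (\<lambda>h. inner h (adjoint f' 1))"
    by blast
  then have "GDERIV f x :> adjoint f' 1"
    using f' by (simp add: gderiv_def)
  then show ?thesis
    using gradient_eqI by metis
qed

lemma has_real_derivative_along_line:
  fixes f :: "'a::euclidean_space \<Rightarrow> real"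
  assumes "f differentiable (at (x + s *\<^sub>R d))"
  shows "((\<lambda>s. f (x + s *\<^sub>R d)) has_real_derivative inner d (gradient f (x + s *\<^sub>R d))) (at s)"
proof -
  have "(f has_derivative (\<lambda>h. inner h (gradient f (x + s *\<^sub>R d)))) (at (x + s *\<^sub>R d))"
    using GDERIV_gradient[OF assms] by (simp add: gderiv_def)
  moreover have "((\<lambda>s. x + s *\<^sub>R d) has_derivative (\<lambda>h. h *\<^sub>R d)) (at s)"
    by (auto intro!: derivative_eq_intros)
  ultimately have "((\<lambda>s. f (x + s *\<^sub>R d)) has_derivative
      (\<lambda>h. inner (h *\<^sub>R d) (gradient f (x + s *\<^sub>R d)))) (at s)"
    by (rule has_derivative_compose[rotated])
  then show ?thesis
    by (simp add: has_field_derivative_def mult_commute_abs)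
qed

text \<open>
  Restricting to the line through \<open>x\<close> and \<open>y\<close> reduces this to the tangent inequality in one real
  variable.
\<close>
lemma convex_above_tangent_plane:
  fixes f :: "'a::euclidean_space \<Rightarrow> real"
  assumes "convex_on UNIV f" and "f differentiable (at x)"
  shows "f x + inner (gradient f x) (y - x) \<le> f y"
proof -
  let ?h = "\<lambda>s. f (x + s *\<^sub>R (y - x))"
  have "convex_on UNIV ?h"
  proof (rule convex_onI)
    fix \<mu> a b :: real assume \<mu>: "0 < \<mu>" "\<mu> < 1"
    have "x + ((1 - \<mu>) *\<^sub>R a + \<mu> *\<^sub>R b) *\<^sub>R (y - x)
        = (1 - \<mu>) *\<^sub>R (x + a *\<^sub>R (y - x)) + \<mu> *\<^sub>R (x + b *\<^sub>R (y - x))"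
      by (simp add: algebra_simps)
    then show "?h ((1 - \<mu>) *\<^sub>R a + \<mu> *\<^sub>R b) \<le> (1 - \<mu>) * ?h a + \<mu> * ?h b"
      using convex_onD[OF assms(1), of \<mu> "x + a *\<^sub>R (y - x)" "x + b *\<^sub>R (y - x)"] \<mu> by simp
  qed simp
  moreover have "(?h has_real_derivative inner (y - x) (gradient f x)) (at 0)"
    using has_real_derivative_along_line[of f x 0 "y - x"] assms(2) by simp
  ultimately have "?h 1 - ?h 0 \<ge> inner (y - x) (gradient f x) * (1 - 0)"
    by (intro convex_on_imp_above_tangent[where A = UNIV]) (auto simp: connected_UNIV)
  then show ?thesis
    by (simp add: inner_commute)
qed

text \<open>
  The descent lemma. Along the segment from \<open>x\<close> to \<open>y\<close>, the difference between \<open>f\<close> and the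
  quadratic on the right has a nonpositive derivative by the Lipschitz bound on the gradient,
  and it vanishes at \<open>x\<close>.
\<close>
lemma L_smooth_upper_bound:
  fixes f :: "'a::euclidean_space \<Rightarrow> real"
  assumes "L_smooth L f"
  shows "f y \<le> f x + inner (gradient f x) (y - x) + L / 2 * (norm (y - x))\<^sup>2"
proof -
  define d where "d = y - x"
  have diff: "f differentiable (at z)" for z
    using assms by (simp add: L_smooth_def)
  have lip: "norm (gradient f u - gradient f v) \<le> L * norm (u - v)" for u v
    using assms by (simp add: L_smooth_def)
  define k where "k s = f (x + s *\<^sub>R d) - s * inner d (gradient f x) - L / 2 * s\<^sup>2 * (norm d)\<^sup>2" for s
  have "k 1 \<le> k 0"
  proof (rule DERIV_nonpos_imp_nonincreasing[of 0 1 k])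
    fix s :: real assume s: "0 \<le> s" "s \<le> 1"
    let ?D = "inner d (gradient f (x + s *\<^sub>R d)) - inner d (gradient f x) - L * s * (norm d)\<^sup>2"
    have "(k has_real_derivative ?D) (at s)"
      unfolding k_def
      by (rule derivative_eq_intros has_real_derivative_along_line diff refl | simp)+
    moreover have "?D \<le> 0"
    proof -
      have "inner d (gradient f (x + s *\<^sub>R d) - gradient f x)
          \<le> norm d * norm (gradient f (x + s *\<^sub>R d) - gradient f x)"
        by (rule norm_cauchy_schwarz)
      also have "\<dots> \<le> norm d * (L * norm (s *\<^sub>R d))"
        using lip[of "x + s *\<^sub>R d" x] by (intro mult_left_mono) auto
      also have "\<dots> = L * s * (norm d)\<^sup>2"
        using s by (simp add: power2_eq_square)
      finally show ?thesis
        by (simp add: inner_diff_right)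
    qed
    ultimately show "\<exists>z. (k has_real_derivative z) (at s) \<and> z \<le> 0"
      by blast
  qed simp
  then show ?thesis
    by (simp add: k_def d_def inner_commute)
qed

text \<open>
  Smoothness improves the tangent inequality by a quadratic term in the difference of the
  gradients. The function \<open>f - \<langle>\<nabla>f(y), \<cdot>\<rangle>\<close> is minimal at \<open>y\<close>, hence its value there is at most
  its value after a gradient step of length \<open>1/L\<close> from \<open>x\<close>, and the descent lemma
  says how much that step gains.
\<close>
lemma convex_L_smooth_lower_bound:
  fixes f :: "'a::euclidean_space \<Rightarrow> real"
  assumes "L > 0" and "convex_on UNIV f" and "L_smooth L f"
  shows "f y + inner (gradient f y) (x - y) + 1 / (2 * L) * (norm (gradient f x - gradient f y))\<^sup>2
    \<le> f x"
proof -
  define e where "e = gradient f x - gradient f y"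
  \<comment> \<open>the gradient step for \<open>f - \<langle>\<nabla>f(y), \<cdot>\<rangle>\<close>, whose gradient at \<open>x\<close> is \<open>e\<close>\<close>
  define w where "w = x - (1 / L) *\<^sub>R e"
  have "f differentiable (at y)"
    using assms by (simp add: L_smooth_def)
  then have "f y + inner (gradient f y) (w - y) \<le> f w"
    by (rule convex_above_tangent_plane[OF assms(2)])
  also have "\<dots> \<le> f x + inner (gradient f x) (w - x) + L / 2 * (norm (w - x))\<^sup>2"
    by (rule L_smooth_upper_bound[OF assms(3)])
  also have "L / 2 * (norm (w - x))\<^sup>2 = 1 / (2 * L) * (norm e)\<^sup>2"
    using assms(1) by (simp add: w_def power2_eq_square)
  finally have "f y + inner (gradient f y) (w - y)
      \<le> f x + inner (gradient f x) (w - x) + 1 / (2 * L) * (norm e)\<^sup>2" .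
  moreover have "inner (gradient f x) (w - x) = - (1 / L) * inner (gradient f x) e"
    by (simp add: w_def)
  moreover have "inner (gradient f y) (w - y)
      = inner (gradient f y) (x - y) - (1 / L) * inner (gradient f y) e"
    by (simp add: w_def inner_diff_right)
  moreover have "inner (gradient f x) e - inner (gradient f y) e = (norm e)\<^sup>2"
    by (simp add: e_def power2_norm_eq_inner inner_diff_left)
  then have "(1 / L) * inner (gradient f x) e - (1 / L) * inner (gradient f y) e
      = (1 / L) * (norm e)\<^sup>2"
    by (metis right_diff_distrib)
  moreover have "(1 / L) * (norm e)\<^sup>2 = 2 * (1 / (2 * L) * (norm e)\<^sup>2)"
    by simp
  ultimately show ?thesis
    unfolding e_def[symmetric] by linarith
qed

section \<open>The proximal map\<close>

lemma convex_fun_combination_le: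
  assumes "convex_fun g" and "g u \<le> ereal a" and "g v \<le> ereal b" and "0 \<le> \<mu>" and "\<mu> \<le> 1"
  shows "g ((1 - \<mu>) *\<^sub>R u + \<mu> *\<^sub>R v) \<le> ereal ((1 - \<mu>) * a + \<mu> * b)"
proof -
  have "(1 - \<mu>) *\<^sub>R (u, a) + \<mu> *\<^sub>R (v, b) \<in> eepigraph g"
    using assms by (intro convexD) (auto simp: convex_fun_def eepigraph_def)
  then show ?thesis
    by (simp add: eepigraph_def)
qed

lemma proper_fun_finite:
  assumes "proper_fun g" and "g u < \<infinity>"
  obtains r where "g u = ereal r"
  using assms by (cases "g u") (auto simp: proper_fun_def)

text \<open>
  Separate the epigraph from a point directly below it. The hyperplane cannot be vertical, since
  the epigraph contains a point above the separated one; so it is the graph of an affine function.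
\<close>
lemma affine_minorant:
  fixes g :: "'a::euclidean_space \<Rightarrow> ereal"
  assumes "proper_fun g" and "closed_fun g" and "convex_fun g"
  obtains a b where "\<And>u. ereal (inner a u + b) \<le> g u"
proof -
  obtain x\<^sub>0 where "g x\<^sub>0 < \<infinity>"
    using assms(1) by (auto simp: proper_fun_def edom_def)
  then obtain r\<^sub>0 where r\<^sub>0: "g x\<^sub>0 = ereal r\<^sub>0"
    by (rule proper_fun_finite[OF assms(1)])
  have "(x\<^sub>0, r\<^sub>0 - 1) \<notin> eepigraph g"
    by (simp add: eepigraph_def r\<^sub>0)
  then obtain n c where n: "inner n (x\<^sub>0, r\<^sub>0 - 1) < c" "\<And>p. p \<in> eepigraph g \<Longrightarrow> c < inner n p"
    using separating_hyperplane_closed_point[of "eepigraph g" "(x\<^sub>0, r\<^sub>0 - 1)"] assms(2,3)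
    unfolding closed_fun_def convex_fun_def by blast
  obtain m \<alpha> where n_eq: "n = (m, \<alpha>)"
    by (cases n)
  have "(x\<^sub>0, r\<^sub>0) \<in> eepigraph g"
    by (simp add: eepigraph_def r\<^sub>0)
  then have \<alpha>: "\<alpha> > 0"
    using n(1) n(2)[of "(x\<^sub>0, r\<^sub>0)"] by (simp add: n_eq algebra_simps)
  have "ereal (inner ((- 1 / \<alpha>) *\<^sub>R m) u + c / \<alpha>) \<le> g u" for u
  proof (cases "g u < \<infinity>")
    case True
    then obtain r where r: "g u = ereal r"
      by (rule proper_fun_finite[OF assms(1)])
    then have "c < inner m u + \<alpha> * r"
      using n(2)[of "(u, r)"] by (simp add: eepigraph_def n_eq)
    then show ?thesis
      using \<alpha> by (simp add: r field_simps)
  qed auto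
  then show ?thesis
    by (rule that)
qed

text \<open>Completing the square puts the sublevel set inside a ball around \<open>z - a\<close>.\<close>
lemma bounded_quadratic_sublevel:
  fixes a z :: "'a::real_inner"
  shows "bounded {u. inner a u + (norm (u - z))\<^sup>2 / 2 \<le> c}"
proof -
  have "u \<in> cball (z - a) (sqrt (2 * \<bar>c\<bar> + 2 * norm a * norm z + (norm a)\<^sup>2))"
    if "inner a u + (norm (u - z))\<^sup>2 / 2 \<le> c" for u
  proof -
    have "(norm (u - (z - a)))\<^sup>2 = (norm (u - z))\<^sup>2 + 2 * inner a u - 2 * inner a z + (norm a)\<^sup>2"
      by (simp add: power2_norm_eq_inner inner_commute algebra_simps)
    also have "\<dots> \<le> 2 * \<bar>c\<bar> + 2 * norm a * norm z + (norm a)\<^sup>2"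
      using that Cauchy_Schwarz_ineq2[of a z] by linarith
    finally show ?thesis
      by (metis dist_norm mem_cball norm_minus_commute real_le_rsqrt)
  qed
  then show ?thesis
    by (intro bounded_subset[OF bounded_cball] subsetI) simp
qed

text \<open>
  Existence of a minimizer, which makes the choice in the definition of the proximal map
  meaningful. The function \<open>g\<close> need not be continuous, so the minimum is taken on
  its epigraph instead: there the objective becomes the continuous function \<open>h\<close> of a point and a
  height, and closedness of \<open>g\<close> is closedness of the domain. The affine minorant of \<open>g\<close> bounds
  the part \<open>K\<close> of the epigraph where \<open>h\<close> does not exceed its value at one chosen point.
\<close>
lemma prox_minimizes:
  fixes g :: "'a::euclidean_space \<Rightarrow> ereal"
  assumes "proper_fun g" and "closed_fun g" and "convex_fun g" and "0 < t"
  shows "ereal t * g (prox t g z) + ereal (1/2 * (norm (prox t g z - z))\<^sup>2)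
    \<le> ereal t * g u + ereal (1/2 * (norm (u - z))\<^sup>2)"
proof -
  let ?F = "\<lambda>u. ereal t * g u + ereal (1/2 * (norm (u - z))\<^sup>2)"
  obtain x\<^sub>0 where "g x\<^sub>0 < \<infinity>"
    using assms(1) by (auto simp: proper_fun_def edom_def)
  then obtain r\<^sub>0 where r\<^sub>0: "g x\<^sub>0 = ereal r\<^sub>0"
    by (rule proper_fun_finite[OF assms(1)])
  obtain a b where ab: "\<And>u. ereal (inner a u + b) \<le> g u"
    using affine_minorant[OF assms(1-3)] by blast
  define h where "h p = t * snd p + (norm (fst p - z))\<^sup>2 / 2" for p :: "'a \<times> real"
  define K where "K = eepigraph g \<inter> {p. h p \<le> h (x\<^sub>0, r\<^sub>0)}"
  have h_cont: "continuous_on S h" for S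
    unfolding h_def by (intro continuous_intros) auto
  have "closed {p. h p \<le> h (x\<^sub>0, r\<^sub>0)}"
    using h_cont by (intro closed_Collect_le) (auto intro: continuous_intros)
  then have "closed K"
    using assms(2) by (simp add: K_def closed_fun_def closed_Int)
  moreover have "bounded K"
  proof -
    define B where "B = {u. inner (t *\<^sub>R a) u + (norm (u - z))\<^sup>2 / 2 \<le> h (x\<^sub>0, r\<^sub>0) - t * b}"
    have "bounded B"
      unfolding B_def by (rule bounded_quadratic_sublevel)
    then obtain M where M: "\<And>u. u \<in> B \<Longrightarrow> norm u \<le> M"
      by (auto simp: bounded_iff)
    have "K \<subseteq> B \<times> {b - norm a * M .. h (x\<^sub>0, r\<^sub>0) / t}"
    proof (clarify, intro conjI)
      fix u r assume "(u, r) \<in> K"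
      then have gr: "g u \<le> ereal r" and hr: "t * r + (norm (u - z))\<^sup>2 / 2 \<le> h (x\<^sub>0, r\<^sub>0)"
        by (auto simp: K_def eepigraph_def h_def)
      have lower: "inner a u + b \<le> r"
        using order_trans[OF ab[of u] gr] by simp
      then have "t * (inner a u + b) \<le> t * r"
        using assms(4) by (intro mult_left_mono) auto
      then show "u \<in> B"
        using hr by (simp add: B_def algebra_simps)
      then have "norm a * norm u \<le> norm a * M"
        using M by (intro mult_left_mono) auto
      then have "b - norm a * M \<le> r"
        using lower Cauchy_Schwarz_ineq2[of a u] by linarith
      moreover have "t * r \<le> h (x\<^sub>0, r\<^sub>0)"
        using hr zero_le_power2[of "norm (u - z)"] by linarith
      then have "r \<le> h (x\<^sub>0, r\<^sub>0) / t"
        using assms(4) by (simp add: field_simps)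
      ultimately show "r \<in> {b - norm a * M .. h (x\<^sub>0, r\<^sub>0) / t}"
        by simp
    qed
    then show ?thesis
      by (rule bounded_subset[rotated]) (intro bounded_Times \<open>bounded B\<close> bounded_closed_interval)
  qed
  ultimately have "compact K"
    by (simp add: compact_eq_bounded_closed)
  moreover have K0: "(x\<^sub>0, r\<^sub>0) \<in> K"
    by (simp add: K_def eepigraph_def r\<^sub>0)
  ultimately obtain p where p: "p \<in> K" "\<And>q. q \<in> K \<Longrightarrow> h p \<le> h q"
    using continuous_attains_inf[of K h] h_cont by blast
  have "?F (fst p) \<le> ?F v" for v
  proof (cases "g v < \<infinity>")
    case True
    then obtain r where r: "g v = ereal r"
      by (rule proper_fun_finite[OF assms(1)])
    have "h p \<le> h (v, r)"
    proof (cases "h (v, r) \<le> h (x\<^sub>0, r\<^sub>0)")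
      case True
      then show ?thesis
        by (intro p) (simp add: K_def eepigraph_def r)
    next
      case False
      then show ?thesis
        using p(2)[OF K0] by linarith
    qed
    moreover have "g (fst p) \<le> ereal (snd p)"
      using p(1) by (cases p) (auto simp: K_def eepigraph_def)
    then have "ereal t * g (fst p) \<le> ereal t * ereal (snd p)"
      using assms(4) by (intro ereal_mult_left_mono) auto
    then have "?F (fst p) \<le> ereal (h p)"
      using add_right_mono[of "ereal t * g (fst p)" "ereal t * ereal (snd p)"
          "ereal (1/2 * (norm (fst p - z))\<^sup>2)"]
      by (simp add: h_def)
    ultimately show ?thesis
      using order_trans[of "?F (fst p)" "ereal (h p)" "ereal (h (v, r))"]
      by (simp add: r h_def)
  next
    case False
    then show ?thesis
      using assms(4) by simp
  qed
  then have "is_arg_min ?F (\<lambda>_. True) (fst p)"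
    by (simp add: is_arg_min_linorder)
  then have "is_arg_min ?F (\<lambda>_. True) (prox t g z)"
    unfolding prox_def arg_min_def by (rule someI)
  then show ?thesis
    by (simp add: is_arg_min_linorder)
qed

definition is_subgradient :: "('a::real_inner \<Rightarrow> ereal) \<Rightarrow> 'a \<Rightarrow> 'a \<Rightarrow> bool" where
  "is_subgradient g x s \<longleftrightarrow> (\<forall>u. g x + ereal (inner s (u - x)) \<le> g u)"

text \<open>Add the two subgradient inequalities, each tested at the other point.\<close>
lemma is_subgradient_monotone:
  assumes "is_subgradient g x s" and "is_subgradient g y r"
    and "g x = ereal a" and "g y = ereal b"
  shows "0 \<le> inner (s - r) (x - y)"
proof -
  have "a + inner s (y - x) \<le> b" "b + inner r (x - y) \<le> a"
    using assms by (auto simp: is_subgradient_def dest: spec[of _ y] spec[of _ x])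
  then show ?thesis
    by (simp add: inner_diff_left inner_diff_right)
qed

lemma prox_in_edom:
  fixes g :: "'a::euclidean_space \<Rightarrow> ereal"
  assumes "proper_fun g" and "closed_fun g" and "convex_fun g" and "0 < t"
  shows "prox t g z \<in> edom g"
proof -
  obtain x\<^sub>0 where "g x\<^sub>0 < \<infinity>"
    using assms(1) by (auto simp: proper_fun_def edom_def)
  then obtain r\<^sub>0 where "g x\<^sub>0 = ereal r\<^sub>0"
    by (rule proper_fun_finite[OF assms(1)])
  then have "ereal t * g (prox t g z) + ereal (1/2 * (norm (prox t g z - z))\<^sup>2) < \<infinity>"
    using prox_minimizes[OF assms, of z x\<^sub>0] by (auto intro: le_less_trans)
  then show ?thesis
    using assms(4) by (auto simp: edom_def)
qed

text \<open>
  The optimality condition of the proximal problem. Moving from the minimizer \<open>p\<close> a fraction \<open>\<mu>\<close> of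
  the way towards \<open>u\<close> does not lower the objective; convexity bounds the change of \<open>g\<close>, and after
  division by \<open>\<mu>\<close> the quadratic remainder disappears as \<open>\<mu>\<close> tends to 0.
\<close>
lemma prox_is_subgradient:
  fixes g :: "'a::euclidean_space \<Rightarrow> ereal"
  assumes "proper_fun g" and "closed_fun g" and "convex_fun g" and "0 < t"
  shows "is_subgradient g (prox t g z) ((1 / t) *\<^sub>R (z - prox t g z))"
  unfolding is_subgradient_def
proof
  fix u
  define p where "p = prox t g z"
  have "g p < \<infinity>"
    using prox_in_edom[OF assms, of z] by (simp add: p_def edom_def)
  then obtain a where a: "g p = ereal a"
    by (rule proper_fun_finite[OF assms(1)])
  show "g (prox t g z) + ereal (inner ((1 / t) *\<^sub>R (z - prox t g z)) (u - prox t g z)) \<le> g u"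
  proof (cases "g u < \<infinity>")
    case True
    then obtain b where b: "g u = ereal b"
      by (rule proper_fun_finite[OF assms(1)])
    have "inner (z - p) (u - p) - t * (b - a) \<le> \<mu> * ((norm (u - p))\<^sup>2 / 2)"
      if \<mu>: "0 < \<mu>" "\<mu> < 1" for \<mu>
    proof -
      let ?w = "(1 - \<mu>) *\<^sub>R p + \<mu> *\<^sub>R u"
      have "g ?w \<le> ereal ((1 - \<mu>) * a + \<mu> * b)"
        using convex_fun_combination_le[OF assms(3), of p a u b \<mu>] \<mu> by (simp add: a b)
      then have "ereal t * g ?w \<le> ereal t * ereal ((1 - \<mu>) * a + \<mu> * b)"
        using assms(4) by (intro ereal_mult_left_mono) auto
      then have "ereal t * g ?w + ereal (1/2 * (norm (?w - z))\<^sup>2)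
          \<le> ereal t * ereal ((1 - \<mu>) * a + \<mu> * b) + ereal (1/2 * (norm (?w - z))\<^sup>2)"
        by (rule add_right_mono)
      with prox_minimizes[OF assms, of z ?w]
      have "ereal t * g p + ereal (1/2 * (norm (p - z))\<^sup>2)
          \<le> ereal t * ereal ((1 - \<mu>) * a + \<mu> * b) + ereal (1/2 * (norm (?w - z))\<^sup>2)"
        unfolding p_def by (rule order_trans)
      then have *: "t * a + 1/2 * (norm (p - z))\<^sup>2
          \<le> t * ((1 - \<mu>) * a + \<mu> * b) + 1/2 * (norm (?w - z))\<^sup>2"
        by (simp add: a)
      have w: "?w - z = (p - z) + \<mu> *\<^sub>R (u - p)"
        by (simp add: algebra_simps)
      have "(norm (?w - z))\<^sup>2
          = (norm (p - z))\<^sup>2 - 2 * \<mu> * inner (z - p) (u - p) + \<mu>\<^sup>2 * (norm (u - p))\<^sup>2"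
        unfolding w power2_norm_eq_inner
        by (simp add: inner_add_left inner_add_right inner_diff_left inner_diff_right
            inner_commute power2_eq_square algebra_simps)
      with * have "\<mu> * (inner (z - p) (u - p) - t * (b - a)) \<le> \<mu> * (\<mu> * ((norm (u - p))\<^sup>2 / 2))"
        by (simp add: power2_eq_square algebra_simps)
      then show ?thesis
        using \<mu> by simp
    qed
    then have "\<forall>\<^sub>F \<mu> in at_right 0.
        inner (z - p) (u - p) - t * (b - a) \<le> \<mu> * ((norm (u - p))\<^sup>2 / 2)"
      by (auto simp: eventually_at_right_field intro!: exI[of _ 1])
    moreover have "((\<lambda>\<mu>. \<mu> * ((norm (u - p))\<^sup>2 / 2)) \<longlongrightarrow> 0 * ((norm (u - p))\<^sup>2 / 2)) (at_right 0)"
      by (intro tendsto_intros)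
    ultimately have "inner (z - p) (u - p) - t * (b - a) \<le> 0 * ((norm (u - p))\<^sup>2 / 2)"
      by (intro tendsto_lowerbound) auto
    then have "a + inner ((1 / t) *\<^sub>R (z - p)) (u - p) \<le> b"
      unfolding inner_scaleR_left using assms(4) by (simp add: field_simps)
    then show ?thesis
      by (simp add: a b flip: p_def)
  qed auto
qed

section \<open>The proximal gradient step\<close>

lemma prox_gradient_is_subgradient:
  fixes f :: "'a::euclidean_space \<Rightarrow> real"
  assumes "proper_fun g" and "closed_fun g" and "convex_fun g" and "0 < t"
  shows "is_subgradient g (x - t *\<^sub>R prox_gradient t f g x) (prox_gradient t f g x - gradient f x)"
proof -
  let ?p = "prox t g (x - t *\<^sub>R gradient f x)"
  have "x - t *\<^sub>R prox_gradient t f g x = ?p"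
    using assms(4) by (simp add: prox_gradient_def)
  moreover have "(1 / t) *\<^sub>R (x - t *\<^sub>R gradient f x - ?p) = prox_gradient t f g x - gradient f x"
    using assms(4) by (simp add: prox_gradient_def algebra_simps)
  ultimately show ?thesis
    using prox_is_subgradient[OF assms, of "x - t *\<^sub>R gradient f x"] by simp
qed

lemma prox_gradient_step_finite:
  fixes f :: "'a::euclidean_space \<Rightarrow> real"
  assumes "proper_fun g" and "closed_fun g" and "convex_fun g" and "0 < t"
  obtains r where "g (x - t *\<^sub>R prox_gradient t f g x) = ereal r"
proof -
  have "g (x - t *\<^sub>R prox_gradient t f g x) < \<infinity>"
    using prox_in_edom[OF assms, of "x - t *\<^sub>R gradient f x"] assms(4)
    by (simp add: prox_gradient_def edom_def)
  then show ?thesis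
    by (rule proper_fun_finite[OF assms(1) _ that])
qed

text \<open>
  When \<open>f\<close> is convex, \<open>\<nabla>f(y) + s\<close> is the general form of a subgradient of \<open>f + g\<close> at \<open>y\<close>.
  Write \<open>G\<close> for the proximal gradient at \<open>y\<close>. Monotonicity between
  \<open>s\<close> at \<open>y\<close> and \<open>G - \<nabla>f(y)\<close> at the next iterate \<open>y - t G\<close> gives
  \<open>\<parallel>G\<parallel>\<^sup>2 \<le> \<langle>\<nabla>f(y) + s, G\<rangle>\<close>, and Cauchy-Schwarz does the rest.
\<close>
lemma norm_prox_gradient_le:
  fixes f :: "'a::euclidean_space \<Rightarrow> real"
  assumes "proper_fun g" and "closed_fun g" and "convex_fun g" and "0 < t"
    and "is_subgradient g y s" and "g y = ereal b"
  shows "norm (prox_gradient t f g y) \<le> norm (gradient f y + s)"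
proof -
  define G where "G = prox_gradient t f g y"
  obtain a where "g (y - t *\<^sub>R G) = ereal a"
    unfolding G_def by (rule prox_gradient_step_finite[OF assms(1-4)])
  then have "0 \<le> inner ((G - gradient f y) - s) ((y - t *\<^sub>R G) - y)"
    using prox_gradient_is_subgradient[OF assms(1-4), of y f] assms(5,6)
    unfolding G_def by (intro is_subgradient_monotone)
  then have "t * inner (G - (gradient f y + s)) G \<le> 0"
    by (simp add: algebra_simps)
  then have "(norm G)\<^sup>2 \<le> inner (gradient f y + s) G"
    using assms(4) by (simp add: mult_le_0_iff inner_diff_left power2_norm_eq_inner)
  also have "\<dots> \<le> norm (gradient f y + s) * norm G"
    by (rule norm_cauchy_schwarz)
  finally have "norm G * norm G \<le> norm (gradient f y + s) * norm G"
    by (simp add: power2_eq_square)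
  then show ?thesis
    unfolding G_def[symmetric]
    by (cases "norm G = 0") (auto simp: mult_le_cancel_right)
qed

text \<open>
  The symmetric decrease estimate. The step size bound \<open>t \<le> 1/L\<close> is what lets the quadratic gain
  \<open>1/(2L) \<parallel>G - H\<parallel>\<^sup>2\<close> of the smooth part complete the square
  \<open>\<langle>H, G\<rangle> + 1/2 \<parallel>G - H\<parallel>\<^sup>2 = 1/2 \<parallel>G\<parallel>\<^sup>2 + 1/2 \<parallel>H\<parallel>\<^sup>2\<close>.
\<close>
lemma prox_gradient_step_decrease:
  fixes f :: "'a::euclidean_space \<Rightarrow> real"
  assumes "L > 0" and "convex_on UNIV f" and "L_smooth L f"
    and g: "proper_fun g" "closed_fun g" "convex_fun g"
    and t: "0 < t" "t \<le> 1 / L"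
    and y_def: "y = x - t *\<^sub>R prox_gradient t f g x"
    and fin: "g x = ereal a" "g y = ereal b"
  shows "t / 2 * (norm (prox_gradient t f g x))\<^sup>2 + t / 2 * (norm (prox_gradient t f g y))\<^sup>2
    \<le> (f x + a) - (f y + b)"
proof -
  define G where "G = prox_gradient t f g x"
  define s where "s = G - gradient f x"
  define H where "H = gradient f y + s"
  have xy: "x - y = t *\<^sub>R G"
    by (simp add: y_def G_def)
  have sub: "is_subgradient g y s"
    unfolding s_def G_def y_def by (rule prox_gradient_is_subgradient[OF g t(1)])
  then have "ereal b + ereal (inner s (x - y)) \<le> ereal a"
    unfolding is_subgradient_def fin[symmetric] by blast
  then have g_le: "b + t * inner s G \<le> a"
    by (simp add: xy)
  have "t / 2 * (norm (G - H))\<^sup>2 \<le> 1 / (2 * L) * (norm (G - H))\<^sup>2"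
    using t by (intro mult_right_mono) auto
  moreover have "gradient f x - gradient f y = G - H"
    by (simp add: H_def s_def)
  ultimately have f_le: "f y + t * inner (gradient f y) G + t / 2 * (norm (G - H))\<^sup>2 \<le> f x"
    using convex_L_smooth_lower_bound[OF assms(1-3), of y x] by (simp add: xy)
  have "t * inner (gradient f y) G + t * inner s G + t / 2 * (norm (G - H))\<^sup>2
      = t * (inner H G + 1/2 * (norm (G - H))\<^sup>2)"
    by (simp add: H_def inner_add_left algebra_simps)
  also have "inner H G + 1/2 * (norm (G - H))\<^sup>2 = 1/2 * (norm G)\<^sup>2 + 1/2 * (norm H)\<^sup>2"
    by (simp add: power2_norm_eq_inner inner_diff_left inner_diff_right inner_commute field_simps)
  finally have "t / 2 * (norm G)\<^sup>2 + t / 2 * (norm H)\<^sup>2 \<le> (f x + a) - (f y + b)"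
    using f_le g_le by (simp add: algebra_simps)
  moreover have "(norm (prox_gradient t f g y))\<^sup>2 \<le> (norm H)\<^sup>2"
    unfolding H_def
    by (intro power_mono norm_prox_gradient_le[OF g t(1) sub fin(2)]) simp
  then have "t / 2 * (norm (prox_gradient t f g y))\<^sup>2 \<le> t / 2 * (norm H)\<^sup>2"
    using t(1) by (intro mult_left_mono) auto
  ultimately show ?thesis
    unfolding G_def by linarith
qed

lemma min_value_attained:
  assumes "attains_min h"
  obtains y where "min_value h = h y" and "\<And>z. h y \<le> h z"
proof -
  obtain y where y: "\<And>z. h y \<le> h z"
    using assms by (auto simp: attains_min_def)
  then have "min_value h = h y"
    unfolding min_value_def by (intro Least_equality) auto
  with y show ?thesis
    by (rule that[rotated])
qed

theorem corollary3p2: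
  fixes f :: "real ^ 'n \<Rightarrow> real"
    and g \<phi> :: "real ^ 'n \<Rightarrow> ereal"
    and L t \<eta> :: real
    and x x_plus :: "real ^ 'n"
  assumes "L > 0"
    and "convex_on UNIV f" and "L_smooth L f"
    and "proper_fun g" and "closed_fun g" and "convex_fun g"
    and "\<phi> = (\<lambda>y. ereal (f y) + g y)"
    and "attains_min \<phi>"
    and "0 < t" and "t \<le> 1 / L"
    and "\<eta> > 0"
    and "\<forall>y\<in>edom \<phi>. ereal (1/2 * (norm (prox_gradient t f g y))\<^sup>2) \<ge> ereal \<eta> * (\<phi> y - min_value \<phi>)"
    and "x \<in> edom \<phi>"
    and "x_plus = x - t *\<^sub>R prox_gradient t f g x"
  shows "\<phi> x_plus - min_value \<phi>
    \<le> ereal ((1 - \<eta> * t) / (1 + \<eta> * t)) * (\<phi> x - min_value \<phi>)"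
proof -
  note \<phi> = assms(7)
  have "g x < \<infinity>"
    using assms(13) by (auto simp: edom_def \<phi>)
  then obtain a where a: "g x = ereal a"
    by (rule proper_fun_finite[OF assms(4)])
  obtain b where b: "g x_plus = ereal b"
    unfolding assms(14) by (rule prox_gradient_step_finite[OF assms(4-6,9)])
  have \<phi>x: "\<phi> x = ereal (f x + a)" and \<phi>p: "\<phi> x_plus = ereal (f x_plus + b)"
    by (simp_all add: \<phi> a b)
  obtain x\<^sub>m where x\<^sub>m: "min_value \<phi> = \<phi> x\<^sub>m" "\<And>z. \<phi> x\<^sub>m \<le> \<phi> z"
    using min_value_attained[OF assms(8)] by blast
  have "g x\<^sub>m < \<infinity>"
    using x\<^sub>m(2)[of x] unfolding \<phi>x by (auto simp: \<phi>)
  then obtain c where "g x\<^sub>m = ereal c"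
    by (rule proper_fun_finite[OF assms(4)])
  then obtain m where m: "min_value \<phi> = ereal m"
    using x\<^sub>m(1) by (auto simp: \<phi>)
  define \<delta> where "\<delta> = f x + a - m"
  define \<delta>' where "\<delta>' = f x_plus + b - m"
  have "x_plus \<in> edom \<phi>"
    by (simp add: edom_def \<phi>p)
  then have "\<eta> * \<delta>' \<le> 1/2 * (norm (prox_gradient t f g x_plus))\<^sup>2"
    using assms(12) by (auto simp: \<delta>'_def \<phi>p m)
  then have 1: "t * (\<eta> * \<delta>') \<le> t / 2 * (norm (prox_gradient t f g x_plus))\<^sup>2"
    using assms(9) mult_left_mono[of "\<eta> * \<delta>'" _ t] by fastforce
  have "\<eta> * \<delta> \<le> 1/2 * (norm (prox_gradient t f g x))\<^sup>2"
    using assms(12,13) by (auto simp: \<delta>_def \<phi>x m)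
  then have 2: "t * (\<eta> * \<delta>) \<le> t / 2 * (norm (prox_gradient t f g x))\<^sup>2"
    using assms(9) mult_left_mono[of "\<eta> * \<delta>" _ t] by fastforce
  have "t * (\<eta> * \<delta>) + t * (\<eta> * \<delta>') \<le> \<delta> - \<delta>'"
    using prox_gradient_step_decrease[OF assms(1-6,9,10,14) a b] 1 2
    by (simp add: \<delta>_def \<delta>'_def)
  then have "\<delta>' * (1 + \<eta> * t) \<le> (1 - \<eta> * t) * \<delta>"
    by (simp add: algebra_simps)
  moreover have "0 < 1 + \<eta> * t"
    using assms(9,11) by (simp add: add_pos_pos)
  ultimately have "\<delta>' \<le> (1 - \<eta> * t) / (1 + \<eta> * t) * \<delta>"
    by (simp add: pos_le_divide_eq)
  then show ?thesis
    by (simp add: \<phi>x \<phi>p m \<delta>_def \<delta>'_def)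
qed

end
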